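(* Let $A$ and $E$ be real symmetric $n\times n$ matrices, $\tilde A=A+E$. Let $\lambda_1\ge\dots\ge\lambda_n$ be the eigenvalues of $A$ with a corresponding orthonormal basis of eigenvectors $u_1,\dots,u_n$, and let $\tilde\lambda_1\ge\dots\ge\tilde\lambda_n$ be the eigenvalues of $\tilde A$ with a corresponding orthonormal basis of eigenvectors $\tilde u_1,\dots,\tilde u_n$. Let $1\le p<n$ be such that $\delta_p:=\lambda_p-\lambda_{p+1}>0$, and put $\Pi_p=\sum_{i=1}^pu_iu_i^T$, $\tilde\Pi_p=\sum_{i=1}^p\tilde u_i\tilde u_i^T$. Let $\bar\lambda>0$ and let $r$ be the smallest index such that $\lambda_p-\lambda_{r+1}>\bar\lambda$ (such an index is assumed to exist). With $x$, $y$, $w$ and $\|E\|_{A,p,\bar\lambda}=\sqrt r\,x+\sqrt r\,y$ as defined in the context, assume that $$\delta_p\ \ge\ \max\Big\{12\,r\,x,\ \frac{144\,r\,w^2}{\bar\lambda}\Big\}.$$ Then $$\|\tilde\Pi_p-\Pi_p\|\ \le\ 12\sqrt p\,\frac{\|E\|_{A,p,\bar\lambda}}{\delta_p}+12\sqrt p\,\frac{\|E\|}{\bar\lambda}.$$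
   Context: $\|\cdot\|$ is the spectral (operator) norm for matrices and the Euclidean norm for vectors. Define - $x:=\max_{1\le i,j\le r}|u_i^TEu_j|$; - $y:=\max_{1\le i\ne j\le r,\ 1\le k\le p}\Big|u_i^TE\Big(\sum_{l\ge r+1}\dfrac{u_lu_l^T}{\lambda_k-\lambda_l}\Big)Eu_j\Big|$ (a maximum over an empty set is $0$); - $w:=\max_{1\le i\le r}\|u_i^TE\|$. The relative norm is $\|E\|_{A,p,\bar\lambda}:=\sqrt r\,x+\sqrt r\,y$. *)

theory Defs
  imports "HOL-Analysis.Analysis"
begin

text \<open>
  Matrices are real n x n with n = CARD('n).  Eigenvalues and eigenvectors are sequences
  indexed by natural numbers, of which only the entries with index 1, ..., n are meaningful.
\<close>

definition spectral_norm :: "real^'n^'n \<Rightarrow> real" where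
  "spectral_norm M = onorm (\<lambda>v. M *v v)"

definition outer :: "real^'n \<Rightarrow> real^'n \<Rightarrow> real^'n^'n" where
  "outer v w = (\<chi> i j. v $ i * w $ j)"

text \<open>
  The n orthonormal vectors form a basis automatically, so \<open>lam 1 \<ge> \<dots> \<ge> lam n\<close> lists all
  eigenvalues of \<open>A\<close> with multiplicity.
\<close>
definition eigensystem :: "real^'n^'n \<Rightarrow> (nat \<Rightarrow> real) \<Rightarrow> (nat \<Rightarrow> real^'n) \<Rightarrow> bool" where
  "eigensystem A lam u \<longleftrightarrow>
     (\<forall>i\<in>{1..CARD('n)}. \<forall>j\<in>{1..CARD('n)}. i \<le> j \<longrightarrow> lam j \<le> lam i) \<and>
     (\<forall>i\<in>{1..CARD('n)}. \<forall>j\<in>{1..CARD('n)}. u i \<bullet> u j = (if i = j then 1 else 0)) \<and>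
     (\<forall>i\<in>{1..CARD('n)}. A *v u i = lam i *\<^sub>R u i)"

definition spectral_projection :: "(nat \<Rightarrow> real^'n) \<Rightarrow> nat \<Rightarrow> real^'n^'n" where
  "spectral_projection u p = (\<Sum>i=1..p. outer (u i) (u i))"

definition max_or_zero :: "real set \<Rightarrow> real" where
  "max_or_zero S = (if S = {} then 0 else Max S)"

definition pert_x :: "real^'n^'n \<Rightarrow> (nat \<Rightarrow> real^'n) \<Rightarrow> nat \<Rightarrow> real" where
  "pert_x E u r = max_or_zero {\<bar>u i \<bullet> (E *v u j)\<bar> | i j. i \<in> {1..r} \<and> j \<in> {1..r}}"

definition resolvent_tail ::
    "(nat \<Rightarrow> real) \<Rightarrow> (nat \<Rightarrow> real^'n) \<Rightarrow> nat \<Rightarrow> nat \<Rightarrow> real^'n^'n" where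
  "resolvent_tail lam u r k =
     (\<Sum>l=r+1..CARD('n). (1 / (lam k - lam l)) *\<^sub>R outer (u l) (u l))"

definition pert_y ::
    "real^'n^'n \<Rightarrow> (nat \<Rightarrow> real) \<Rightarrow> (nat \<Rightarrow> real^'n) \<Rightarrow> nat \<Rightarrow> nat \<Rightarrow> real" where
  "pert_y E lam u p r =
     max_or_zero {\<bar>u i \<bullet> ((E ** resolvent_tail lam u r k ** E) *v u j)\<bar> | i j k.
       i \<in> {1..r} \<and> j \<in> {1..r} \<and> i \<noteq> j \<and> k \<in> {1..p}}"

definition pert_w :: "real^'n^'n \<Rightarrow> (nat \<Rightarrow> real^'n) \<Rightarrow> nat \<Rightarrow> real" where
  "pert_w E u r = max_or_zero {norm (u i v* E) | i. i \<in> {1..r}}"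

text \<open>
  The dependence of the relative norm on \<open>A\<close> is through \<open>lam\<close> and \<open>u\<close>, that on the threshold
  \<open>lbar\<close> through the index \<open>r\<close> it determines.
\<close>
definition relative_norm ::
    "real^'n^'n \<Rightarrow> (nat \<Rightarrow> real) \<Rightarrow> (nat \<Rightarrow> real^'n) \<Rightarrow> nat \<Rightarrow> nat \<Rightarrow> real" where
  "relative_norm E lam u p r = sqrt (real r) * pert_x E u r + sqrt (real r) * pert_y E lam u p r"

definition threshold_index :: "nat \<Rightarrow> (nat \<Rightarrow> real) \<Rightarrow> nat \<Rightarrow> real \<Rightarrow> nat \<Rightarrow> bool" where
  "threshold_index n lam p lbar r \<longleftrightarrow>
     r \<in> {1..<n} \<and> lam p - lam (r + 1) > lbar \<and>
     (\<forall>s\<in>{1..<n}. lam p - lam (s + 1) > lbar \<longrightarrow> r \<le> s)"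

end

theory Submission
  imports Defs
begin

text \<open>
  The argument compares eigenvectors directly.  With orthonormal \<open>u\<^sub>i\<close> and \<open>u'\<^sub>i\<close>, the
  difference of the two projections is controlled by the leakage
  \<open>S\<^sup>2 = (\<Sum>k\<le>p. \<parallel>(1 - \<Pi>) u'\<^sub>k\<parallel>\<^sup>2)\<close>, namely \<open>\<parallel>\<Pi>' - \<Pi>\<parallel> \<le> 2 S\<close>
  (\<open>norm_proj_difference_le\<close>).  Trivially \<open>S \<le> sqrt p\<close>, which settles the case
  \<open>6 \<parallel>E\<parallel> > lbar\<close>; from now on \<open>6 \<parallel>E\<parallel> \<le> lbar\<close>.

  Fix \<open>k \<le> p\<close>, write \<open>\<mu>\<close> for the \<open>k\<close>-th eigenvalue of \<open>A + E\<close>, and split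
  \<open>u'\<^sub>k = a + m + z\<close> along the indices \<open>1..p\<close> (top), \<open>p+1..r\<close> (middle) and \<open>r+1..n\<close> (tail)
  of the basis \<open>u\<close>.  The Courant-Fischer principle on the span of \<open>u\<^sub>1, \<dots>, u\<^sub>p\<close>, to which
  \<open>E\<close> compresses with norm at most \<open>p x \<le> \<delta> / 12\<close>, gives \<open>\<mu> \<ge> \<lambda>\<^sub>p - \<delta> / 12\<close> (\<open>mu_ge\<close>).  Everything then
  follows from the coordinates \<open>(\<mu> - \<lambda>\<^sub>l) (u\<^sub>l \<bullet> u'\<^sub>k) = u\<^sub>l \<bullet> E u'\<^sub>k\<close> of the eigenvalue equation.

  On the tail \<open>\<mu> - \<lambda>\<^sub>l\<close> is at least \<open>11/12 lbar\<close>, so \<open>\<parallel>z\<parallel>\<close> is at most of order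
  \<open>\<parallel>E\<parallel> / lbar\<close>, and also at most of order \<open>sqrt r w / lbar\<close> (\<open>tail_le\<close>).

  For the middle, eliminate the tail as in a Schur complement: with
  \<open>T = (\<Sum>l>r. (1 / (\<lambda>\<^sub>p - \<lambda>\<^sub>l)) u\<^sub>l u\<^sub>l\<^sup>T)\<close> and \<open>G = E + E T E\<close>,
  \<open>(\<mu> - \<lambda>\<^sub>j) (u\<^sub>j \<bullet> m) = u\<^sub>j \<bullet> G a + u\<^sub>j \<bullet> G m + u\<^sub>j \<bullet> q\<close>   for \<open>j = p+1, \<dots>, r\<close>,
  where \<open>q = E (z - T E (a + m))\<close>.  The middle block of \<open>G\<close> has norm at most \<open>13/144 \<delta>\<close> by the
  two hypotheses on \<open>\<delta>\<close>, and is absorbed by \<open>\<mu> - \<lambda>\<^sub>j \<ge> 11/12 \<delta>\<close> (\<open>mid_block_le\<close>).  The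
  remainder \<open>q\<close> costs a multiple of \<open>\<parallel>E\<parallel> / lbar\<close> after division by \<open>\<mu> - \<lambda>\<^sub>p\<^sub>+\<^sub>1\<close>
  (\<open>mid_remainder_le\<close>).  The coupling \<open>u\<^sub>j \<bullet> G u\<^sub>i\<close> of middle and top has entries at most
  \<open>x + y\<close>, hence Frobenius norm at most \<open>sqrt (r p) (x + y)\<close>; because \<open>G\<close> does not depend on \<open>k\<close>,
  Bessel's inequality sums its contributions over all \<open>k \<le> p\<close> at no further cost
  (\<open>coupling_le\<close>).  Altogether \<open>S\<close> is at most
  \<open>2 sqrt p sqrt r (x + y) / \<delta> + 3 sqrt p \<parallel>E\<parallel> / lbar\<close> (\<open>leakage_le\<close>).
\<close>

section \<open>Orthonormal families and diagonal operators\<close>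

definition orthonormal_on :: "'i set \<Rightarrow> ('i \<Rightarrow> 'a::real_inner) \<Rightarrow> bool" where
  "orthonormal_on I u \<longleftrightarrow> (\<forall>i\<in>I. \<forall>j\<in>I. u i \<bullet> u j = (if i = j then 1 else 0))"

text \<open>
  The operator \<open>\<Sum>i\<in>I. f i u\<^sub>i u\<^sub>i\<^sup>T\<close>.  Projections, partial resolvents and their differences
  all have this form.
\<close>
definition spectral_sum ::
    "('i \<Rightarrow> 'a::real_inner) \<Rightarrow> 'i set \<Rightarrow> ('i \<Rightarrow> real) \<Rightarrow> 'a \<Rightarrow> 'a" where
  "spectral_sum u I f a = (\<Sum>i\<in>I. (f i * (u i \<bullet> a)) *\<^sub>R u i)"

abbreviation proj :: "('i \<Rightarrow> 'a::real_inner) \<Rightarrow> 'i set \<Rightarrow> 'a \<Rightarrow> 'a" where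
  "proj u I \<equiv> spectral_sum u I (\<lambda>_. 1)"

text \<open>
  Index ranges start at \<open>1\<close>; keeping that numeral folded lets facts about such ranges match.
\<close>
declare One_nat_def [simp del]

lemma orthonormal_on_subset: "orthonormal_on I u \<Longrightarrow> J \<subseteq> I \<Longrightarrow> orthonormal_on J u"
  unfolding orthonormal_on_def by blast

lemma orthonormal_onD: "orthonormal_on I u \<Longrightarrow> i \<in> I \<Longrightarrow> j \<in> I \<Longrightarrow> u i \<bullet> u j = (if i = j then 1 else 0)"
  unfolding orthonormal_on_def by blast

lemma norm_linear_combination_le:
  fixes x :: "'i \<Rightarrow> 'a::real_normed_vector"
  shows "norm (\<Sum>i\<in>I. c i *\<^sub>R x i) \<le> L2_set c I * L2_set (\<lambda>i. norm (x i)) I"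
proof -
  have "norm (\<Sum>i\<in>I. c i *\<^sub>R x i) \<le> (\<Sum>i\<in>I. \<bar>c i\<bar> * \<bar>norm (x i)\<bar>)"
    by (rule order_trans[OF norm_sum]) simp
  also have "\<dots> \<le> L2_set c I * L2_set (\<lambda>i. norm (x i)) I"
    by (rule L2_set_mult_ineq)
  finally show ?thesis .
qed

lemma L2_set_le_sqrt_card:
  assumes "\<And>i. i \<in> I \<Longrightarrow> \<bar>f i\<bar> \<le> c" and "0 \<le> c"
  shows "L2_set f I \<le> sqrt (card I) * c"
proof -
  have "(\<Sum>i\<in>I. (f i)\<^sup>2) \<le> of_nat (card I) * c\<^sup>2"
    by (rule sum_bounded_above) (use assms in \<open>auto simp: abs_le_square_iff[symmetric]\<close>)
  then have "L2_set f I \<le> sqrt (real (card I) * c\<^sup>2)"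
    unfolding L2_set_def by (rule real_sqrt_le_mono)
  with assms(2) show ?thesis by (simp add: real_sqrt_mult)
qed

lemma L2_set_abs: "L2_set (\<lambda>i. \<bar>f i\<bar>) I = L2_set f I"
  by (simp add: L2_set_def)

lemma L2_set_le_abs:
  assumes "\<And>i. i \<in> I \<Longrightarrow> \<bar>f i\<bar> \<le> \<bar>g i\<bar>"
  shows "L2_set f I \<le> L2_set g I"
  by (subst (1 2) L2_set_abs[symmetric], rule L2_set_mono) (use assms in auto)

lemma inner_spectral_sum:
  assumes "orthonormal_on J u" "I \<subseteq> J" "finite J" "j \<in> J"
  shows "u j \<bullet> spectral_sum u I f a = (if j \<in> I then f j * (u j \<bullet> a) else 0)"
proof -
  have fin: "finite I" using assms finite_subset by blast
  have "u j \<bullet> spectral_sum u I f a = (\<Sum>i\<in>I. if i = j then f j * (u j \<bullet> a) else 0)"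
    unfolding spectral_sum_def inner_sum_right
    by (rule sum.cong) (use assms in \<open>auto simp: orthonormal_onD\<close>)
  also have "\<dots> = (if j \<in> I then f j * (u j \<bullet> a) else 0)"
    using fin by simp
  finally show ?thesis .
qed

lemma norm_spectral_sum:
  assumes "orthonormal_on I u" "finite I"
  shows "norm (spectral_sum u I f a) = L2_set (\<lambda>i. f i * (u i \<bullet> a)) I"
proof -
  have "spectral_sum u I f a \<bullet> spectral_sum u I f a = (\<Sum>i\<in>I. (f i * (u i \<bullet> a))\<^sup>2)"
    by (subst (1) spectral_sum_def)
      (simp add: inner_sum_left inner_spectral_sum[OF assms(1) order_refl assms(2)] power2_eq_square)
  then show ?thesis by (simp add: norm_eq_sqrt_inner L2_set_def)
qed

lemma inner_spectral_sum_commute: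
  "b \<bullet> spectral_sum u I f a = spectral_sum u I f b \<bullet> a"
  by (simp add: spectral_sum_def inner_sum_left inner_sum_right inner_commute mult_ac)

lemma norm_minus_proj:
  assumes "orthonormal_on I u" "finite I"
  shows "(norm (a - proj u I a))\<^sup>2 = (norm a)\<^sup>2 - (\<Sum>i\<in>I. (u i \<bullet> a)\<^sup>2)"
proof -
  have 1: "a \<bullet> proj u I a = (\<Sum>i\<in>I. (u i \<bullet> a)\<^sup>2)"
    by (simp add: spectral_sum_def inner_sum_right power2_eq_square inner_commute)
  have 2: "proj u I a \<bullet> proj u I a = (\<Sum>i\<in>I. (u i \<bullet> a)\<^sup>2)"
    using norm_spectral_sum[OF assms, of "\<lambda>_. 1" a]
    by (simp add: dot_square_norm L2_set_def sum_nonneg)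
  show ?thesis
    unfolding power2_norm_eq_inner
    using 1 2 by (simp add: inner_diff_left inner_diff_right inner_commute)
qed

lemma bessel_inequality:
  assumes "orthonormal_on I u" "finite I"
  shows "L2_set (\<lambda>i. u i \<bullet> a) I \<le> norm a"
proof -
  have "(\<Sum>i\<in>I. (u i \<bullet> a)\<^sup>2) \<le> (norm a)\<^sup>2"
    using norm_minus_proj[OF assms, of a] zero_le_power2[of "norm (a - proj u I a)"] by linarith
  then show ?thesis unfolding L2_set_def by (rule real_le_lsqrt[OF norm_ge_zero])
qed

lemma norm_spectral_sum_le:
  assumes "orthonormal_on I u" "finite I" "\<And>i. i \<in> I \<Longrightarrow> \<bar>f i\<bar> \<le> c" "0 \<le> c"
  shows "norm (spectral_sum u I f a) \<le> c * norm a"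
proof -
  have "norm (spectral_sum u I f a) \<le> L2_set (\<lambda>i. c * (u i \<bullet> a)) I"
    unfolding norm_spectral_sum[OF assms(1,2)]
    by (rule L2_set_le_abs) (use assms in \<open>auto simp: abs_mult intro!: mult_right_mono\<close>)
  also have "\<dots> = c * L2_set (\<lambda>i. u i \<bullet> a) I"
    by (rule L2_set_right_distrib[symmetric, OF assms(4)])
  also have "\<dots> \<le> c * norm a"
    by (rule mult_left_mono[OF bessel_inequality[OF assms(1,2)] assms(4)])
  finally show ?thesis .
qed

lemma linear_spectral_sum: "linear (spectral_sum u I f)"
  by (rule linearI)
    (simp_all add: spectral_sum_def inner_add_right algebra_simps sum.distrib scaleR_sum_right)

text \<open>
  With \<open>P\<close>, \<open>Q\<close> the projections on the spans of \<open>u\<close> and \<open>v\<close>, one has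
  \<open>Q - P = (1 - P) Q - P (1 - Q)\<close>.  Since both families have the same number of members, the two
  summands have the same Frobenius norm, the square of which is
  \<open>card I - (\<Sum>i k. (u\<^sub>i \<bullet> v\<^sub>k)\<^sup>2)\<close>.
\<close>
lemma norm_proj_difference_le:
  assumes u: "orthonormal_on I u" and v: "orthonormal_on I v" and fin: "finite I"
  shows "norm (proj v I a - proj u I a) \<le> 2 * L2_set (\<lambda>k. norm (v k - proj u I (v k))) I * norm a"
proof -
  let ?S = "L2_set (\<lambda>k. norm (v k - proj u I (v k))) I"
  interpret P: linear "proj u I" by (rule linear_spectral_sum)
  interpret Q: linear "proj v I" by (rule linear_spectral_sum)
  have sq: "(\<Sum>i\<in>I. (norm (u i - proj v I (u i)))\<^sup>2) = (\<Sum>k\<in>I. (norm (v k - proj u I (v k)))\<^sup>2)"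
  proof -
    have n: "norm (u i) = 1" "norm (v i) = 1" if "i \<in> I" for i
      using that u v by (simp_all add: orthonormal_onD norm_eq_sqrt_inner)
    have "(\<Sum>i\<in>I. (norm (u i - proj v I (u i)))\<^sup>2) = (\<Sum>i\<in>I. 1 - (\<Sum>k\<in>I. (v k \<bullet> u i)\<^sup>2))"
      by (rule sum.cong) (auto simp: norm_minus_proj[OF v fin] n)
    also have "\<dots> = (\<Sum>i\<in>I. 1) - (\<Sum>k\<in>I. \<Sum>i\<in>I. (v k \<bullet> u i)\<^sup>2)"
      unfolding sum_subtractf by (subst sum.swap) (rule refl)
    also have "\<dots> = (\<Sum>k\<in>I. 1 - (\<Sum>i\<in>I. (u i \<bullet> v k)\<^sup>2))"
      unfolding sum_subtractf by (simp add: inner_commute)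
    also have "\<dots> = (\<Sum>k\<in>I. (norm (v k - proj u I (v k)))\<^sup>2)"
      by (rule sum.cong) (auto simp: norm_minus_proj[OF u fin] n)
    finally show ?thesis .
  qed
  have 1: "proj v I a - proj u I (proj v I a) = (\<Sum>k\<in>I. (v k \<bullet> a) *\<^sub>R (v k - proj u I (v k)))"
  proof -
    have "proj u I (proj v I a) = (\<Sum>k\<in>I. (v k \<bullet> a) *\<^sub>R proj u I (v k))"
      unfolding spectral_sum_def[of v] by (simp add: P.sum P.scale)
    then show ?thesis
      unfolding spectral_sum_def[of v]
      by (simp add: scaleR_diff_right sum_subtractf)
  qed
  have "norm (proj v I a - proj u I (proj v I a)) \<le> L2_set (\<lambda>k. v k \<bullet> a) I * ?S"
    unfolding 1 by (rule norm_linear_combination_le)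
  also have "\<dots> \<le> norm a * ?S"
    by (rule mult_right_mono[OF bessel_inequality[OF v fin]]) simp
  finally have b1: "norm (proj v I a - proj u I (proj v I a)) \<le> norm a * ?S" .
  have "norm (proj u I (a - proj v I a)) = L2_set (\<lambda>i. u i \<bullet> (a - proj v I a)) I"
    using norm_spectral_sum[OF u fin, of "\<lambda>_. 1"] by simp
  also have "\<dots> = L2_set (\<lambda>i. (u i - proj v I (u i)) \<bullet> a) I"
    by (rule L2_set_cong) (simp_all add: inner_diff_left inner_diff_right inner_spectral_sum_commute)
  also have "\<dots> \<le> L2_set (\<lambda>i. norm a * norm (u i - proj v I (u i))) I"
    by (rule L2_set_le_abs)
      (simp, subst mult.commute, rule Cauchy_Schwarz_ineq2)
  also have "\<dots> = norm a * L2_set (\<lambda>i. norm (u i - proj v I (u i))) I"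
    by (rule L2_set_right_distrib[symmetric]) simp
  also have "L2_set (\<lambda>i. norm (u i - proj v I (u i))) I = ?S"
    unfolding L2_set_def sq ..
  finally have b2: "norm (proj u I (a - proj v I a)) \<le> norm a * ?S" .
  have "proj v I a - proj u I a
      = (proj v I a - proj u I (proj v I a)) - proj u I (a - proj v I a)"
    by (simp add: P.diff)
  then have "norm (proj v I a - proj u I a)
      \<le> norm (proj v I a - proj u I (proj v I a)) + norm (proj u I (a - proj v I a))"
    by (simp only: norm_triangle_ineq4)
  with b1 b2 have "norm (proj v I a - proj u I a) \<le> 2 * (norm a * ?S)" by linarith
  then show ?thesis by (simp add: mult_ac)
qed

section \<open>Bounds for matrices with small entries\<close>

lemma L2_set_matrix_vector_le:
  fixes M :: "'j \<Rightarrow> 'i \<Rightarrow> real"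
  assumes "\<And>j i. j \<in> J \<Longrightarrow> i \<in> I \<Longrightarrow> \<bar>M j i\<bar> \<le> m" "0 \<le> m"
  shows "L2_set (\<lambda>j. \<Sum>i\<in>I. M j i * c i) J \<le> sqrt (card J) * (sqrt (card I) * m) * L2_set c I"
proof -
  have "\<bar>\<Sum>i\<in>I. M j i * c i\<bar> \<le> sqrt (card I) * m * L2_set c I" if "j \<in> J" for j
  proof -
    have "\<bar>\<Sum>i\<in>I. M j i * c i\<bar> \<le> L2_set (M j) I * L2_set c I"
      using norm_linear_combination_le[of "M j" c I]
      by (simp add: L2_set_abs)
    also have "\<dots> \<le> sqrt (card I) * m * L2_set c I"
      by (rule mult_right_mono[OF L2_set_le_sqrt_card]) (use assms that in auto)
    finally show ?thesis .
  qed
  then have "L2_set (\<lambda>j. \<Sum>i\<in>I. M j i * c i) J \<le> sqrt (card J) * (sqrt (card I) * m * L2_set c I)"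
    by (rule L2_set_le_sqrt_card) (use assms in auto)
  then show ?thesis by (simp add: mult_ac)
qed

lemma L2_set_L2_set_swap:
  "L2_set (\<lambda>k. L2_set (\<lambda>j. F k j) J) K = L2_set (\<lambda>j. L2_set (\<lambda>k. F k j) K) J"
proof -
  have "(\<Sum>k\<in>K. \<Sum>j\<in>J. (F k j)\<^sup>2) = (\<Sum>j\<in>J. \<Sum>k\<in>K. (F k j)\<^sup>2)" by (rule sum.swap)
  then show ?thesis by (simp add: L2_set_def sum_nonneg)
qed

text \<open>
  The Frobenius norm of a product \<open>M U\<^sup>T V\<close>, with \<open>U\<close> and \<open>V\<close> having orthonormal columns, is at
  most that of \<open>M\<close>: row \<open>j\<close> lists the inner products of the vectors \<open>v\<^sub>k\<close> with
  \<open>\<Sum>i. M j i u\<^sub>i\<close>.  A bound for each \<open>k\<close> separately would lose a factor of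
  \<open>sqrt (card K)\<close>.
\<close>
lemma L2_set_block_le:
  fixes M :: "'j \<Rightarrow> 'i \<Rightarrow> real"
  assumes u: "orthonormal_on I u" "finite I" and v: "orthonormal_on K v" "finite K"
    and M: "\<And>j i. j \<in> J \<Longrightarrow> i \<in> I \<Longrightarrow> \<bar>M j i\<bar> \<le> m" "0 \<le> m"
  shows "L2_set (\<lambda>k. L2_set (\<lambda>j. \<Sum>i\<in>I. M j i * (u i \<bullet> v k)) J) K
    \<le> sqrt (card J) * (sqrt (card I) * m)"
proof -
  have "L2_set (\<lambda>k. \<Sum>i\<in>I. M j i * (u i \<bullet> v k)) K \<le> sqrt (card I) * m" if j: "j \<in> J" for j
  proof -
    define b where "b = (\<Sum>i\<in>I. M j i *\<^sub>R u i)"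
    have "norm b = L2_set (M j) I"
    proof -
      have "b \<bullet> b = (\<Sum>i\<in>I. \<Sum>l\<in>I. M j i * (M j l * (u i \<bullet> u l)))"
        unfolding b_def by (simp add: inner_sum_left inner_sum_right mult_ac inner_commute)
      also have "\<dots> = (\<Sum>i\<in>I. \<Sum>l\<in>I. if l = i then (M j i)\<^sup>2 else 0)"
        by (intro sum.cong refl) (auto simp: orthonormal_onD[OF u(1)] power2_eq_square)
      finally show ?thesis
        using u(2) by (simp add: norm_eq_sqrt_inner L2_set_def)
    qed
    also have "\<dots> \<le> sqrt (card I) * m"
      by (rule L2_set_le_sqrt_card) (use M j in auto)
    finally have nb: "norm b \<le> sqrt (card I) * m" .
    have "L2_set (\<lambda>k. \<Sum>i\<in>I. M j i * (u i \<bullet> v k)) K = L2_set (\<lambda>k. v k \<bullet> b) K"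
      unfolding b_def by (simp add: inner_sum_right inner_commute)
    also have "\<dots> \<le> norm b" by (rule bessel_inequality[OF v])
    finally show ?thesis using nb by linarith
  qed
  then show ?thesis
    unfolding L2_set_L2_set_swap[of _ J K]
    by (intro L2_set_le_sqrt_card) (use M in auto)
qed

section \<open>Full orthonormal families and the Courant-Fischer bound\<close>

lemma orthonormal_expansion:
  fixes u :: "nat \<Rightarrow> 'a::euclidean_space"
  assumes u: "orthonormal_on I u" and "finite I" "card I = DIM('a)"
  shows "proj u I a = a"
proof -
  have inj: "inj_on u I"
  proof
    fix i j assume "i \<in> I" "j \<in> I" "u i = u j"
    then show "i = j" using orthonormal_onD[OF u, of i j] orthonormal_onD[OF u, of j j]
      by (auto split: if_splits)
  qed
  have po: "pairwise orthogonal (u ` I)"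
    by (auto simp: pairwise_def orthogonal_def orthonormal_onD[OF u])
  have n: "norm b = 1" if "b \<in> u ` I" for b
    using that by (auto simp: norm_eq_sqrt_inner orthonormal_onD[OF u])
  have "independent (u ` I)"
    by (rule pairwise_orthogonal_independent[OF po]) (use n in force)
  then have "UNIV \<subseteq> span (u ` I)"
    by (intro card_ge_dim_independent) (use assms(3) inj in \<open>auto simp: card_image\<close>)
  then have "(\<Sum>b\<in>u ` I. (a \<bullet> b) *\<^sub>R b) = a"
    by (intro orthonormal_basis_expand[OF po n]) (use assms in auto)
  then show ?thesis
    by (simp add: sum.reindex[OF inj] spectral_sum_def inner_commute)
qed


text \<open>
  One half of the Courant-Fischer principle.  The \<open>p\<close>-dimensional span of \<open>u\<close> contains a vector
  \<open>c \<noteq> 0\<close> orthogonal to the \<open>p - 1\<close> eigenvectors \<open>v\<^sub>1, \<dots>, v\<^sub>p\<^sub>-\<^sub>1\<close>, and on such a vector the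
  quadratic form of \<open>B\<close> is at most \<open>mu p * (norm c)\<^sup>2\<close>.
\<close>
lemma eigenvalue_ge_of_quadratic_form:
  fixes B :: "'a::euclidean_space \<Rightarrow> 'a" and u v :: "nat \<Rightarrow> 'a"
  assumes "linear B" and v: "orthonormal_on {1..DIM('a)} v"
    and Bv: "\<And>i. i \<in> {1..DIM('a)} \<Longrightarrow> B (v i) = mu i *\<^sub>R v i"
    and mu: "\<And>i j. 1 \<le> i \<Longrightarrow> i \<le> j \<Longrightarrow> j \<le> DIM('a) \<Longrightarrow> mu j \<le> mu i"
    and u: "orthonormal_on {1..p} u" and p: "1 \<le> p" "p \<le> DIM('a)"
    and form: "\<And>c. proj u {1..p} c = c \<Longrightarrow> \<alpha> * (norm c)\<^sup>2 \<le> c \<bullet> B c"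
  shows "\<alpha> \<le> mu p"
proof -
  interpret B: linear B by fact
  let ?N = "{1..DIM('a)}" and ?I = "{1..p}"
  let ?U = "u ` ?I" and ?S = "(\<lambda>j. proj u ?I (v j)) ` {1..<p}"
  have inj: "inj_on u ?I"
  proof
    fix i j assume "i \<in> ?I" "j \<in> ?I" "u i = u j"
    then show "i = j" using orthonormal_onD[OF u, of i j] orthonormal_onD[OF u, of j j]
      by (auto split: if_splits)
  qed
  have "independent ?U"
  proof (rule pairwise_orthogonal_independent)
    show "pairwise orthogonal ?U"
      by (auto simp: pairwise_def orthogonal_def orthonormal_onD[OF u])
    show "0 \<notin> ?U"
      using orthonormal_onD[OF u] by (metis (no_types, lifting) imageE inner_zero_left zero_neq_one)
  qed
  then have "dim ?U = card ?U" by (rule dim_eq_card_independent)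
  then have dimU: "dim ?U = p" by (simp add: card_image[OF inj])
  have "card ?S \<le> card {1..<p}" by (rule card_image_le) simp
  then have dimS: "dim ?S < p"
    using dim_le_card'[of ?S] p by simp
  have "?S \<subseteq> span ?U"
    unfolding spectral_sum_def by (intro image_subsetI span_sum span_scale span_base) simp
  then have sub: "span ?S \<subseteq> span ?U" by (simp add: span_minimal)
  have "span ?S \<noteq> span ?U"
    using dimS dimU dim_span by (metis less_irrefl)
  with sub have "span ?S \<subset> span ?U" by blast
  then obtain c where c: "c \<noteq> 0" "c \<in> span ?U" "\<And>b. b \<in> span ?S \<Longrightarrow> orthogonal c b"
    by (rule orthogonal_to_subspace_exists_gen) blast
  \<comment> \<open>On the span of \<open>u\<close>, being orthogonal to a projected vector is being orthogonal to the vector.\<close>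
  have cu: "proj u ?I c = c"
  proof -
    interpret P: linear "proj u ?I" by (rule linear_spectral_sum)
    have "proj u ?I (u j) = u j" if "j \<in> ?I" for j
    proof -
      have "proj u ?I (u j) = (\<Sum>i\<in>?I. if i = j then u j else 0)"
        unfolding spectral_sum_def using that
        by (intro sum.cong) (auto simp: orthonormal_onD[OF u])
      then show ?thesis using that by simp
    qed
    then have "proj u ?I b = id b" if "b \<in> ?U" for b using that by auto
    from linear_eq_on[OF linear_spectral_sum linear_id c(2) this] show ?thesis by simp
  qed
  have orth: "v j \<bullet> c = 0" if "j \<in> {1..<p}" for j
  proof -
    have "proj u ?I (v j) \<bullet> c = 0"
      using c(3)[of "proj u ?I (v j)"] that by (auto simp: orthogonal_def inner_commute span_base)
    then show ?thesis by (simp add: inner_spectral_sum_commute[symmetric] cu)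
  qed
  have cv: "c = (\<Sum>i\<in>?N. (v i \<bullet> c) *\<^sub>R v i)"
    using orthonormal_expansion[OF v, of c] by (simp add: spectral_sum_def)
  have "B c = (\<Sum>i\<in>?N. (v i \<bullet> c) *\<^sub>R mu i *\<^sub>R v i)"
    by (subst (1) cv) (simp add: B.sum B.scale Bv)
  then have "c \<bullet> B c = (\<Sum>i\<in>?N. mu i * (v i \<bullet> c)\<^sup>2)"
    by (simp add: inner_sum_right power2_eq_square mult_ac inner_commute)
  also have "\<dots> \<le> (\<Sum>i\<in>?N. mu p * (v i \<bullet> c)\<^sup>2)"
  proof (rule sum_mono)
    fix i assume i: "i \<in> ?N"
    show "mu i * (v i \<bullet> c)\<^sup>2 \<le> mu p * (v i \<bullet> c)\<^sup>2"
      using i orth[of i] mu[of p i] p by (cases "i < p") (auto intro!: mult_right_mono)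
  qed
  also have "\<dots> = mu p * (norm c)\<^sup>2"
    using norm_minus_proj[OF v, of c] orthonormal_expansion[OF v, of c]
    by (simp add: sum_distrib_left)
  finally have "\<alpha> * (norm c)\<^sup>2 \<le> mu p * (norm c)\<^sup>2" using form[OF cu] by linarith
  then show ?thesis using c(1) by simp
qed

section \<open>Eigenvectors of the perturbed operator in the unperturbed basis\<close>

text \<open>
  The setting in which the perturbation is small: \<open>lam\<close>, \<open>u\<close> belong to \<open>A\<close> and \<open>mu\<close>, \<open>v\<close> to
  \<open>A + E\<close>.  The numbers \<open>x\<close>, \<open>y\<close>, \<open>w\<close>, \<open>e\<close> are upper bounds for the corresponding maxima and
  for the operator norm of \<open>E\<close>.
\<close>
locale perturbed_eigenbasis =
  fixes A E :: "'a::euclidean_space \<Rightarrow> 'a"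
    and lam mu :: "nat \<Rightarrow> real" and u v :: "nat \<Rightarrow> 'a"
    and p r :: nat and x y w e lbar :: real
  assumes linA: "linear A" and linE: "linear E"
    and selfA: "a \<bullet> A b = A a \<bullet> b" and selfE: "a \<bullet> E b = E a \<bullet> b"
    and u: "orthonormal_on {1..DIM('a)} u" and v: "orthonormal_on {1..DIM('a)} v"
    and Au: "i \<in> {1..DIM('a)} \<Longrightarrow> A (u i) = lam i *\<^sub>R u i"
    and Bv: "i \<in> {1..DIM('a)} \<Longrightarrow> A (v i) + E (v i) = mu i *\<^sub>R v i"
    and lam_mono: "1 \<le> i \<Longrightarrow> i \<le> j \<Longrightarrow> j \<le> DIM('a) \<Longrightarrow> lam j \<le> lam i"
    and mu_mono: "1 \<le> i \<Longrightarrow> i \<le> j \<Longrightarrow> j \<le> DIM('a) \<Longrightarrow> mu j \<le> mu i"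
    and p: "1 \<le> p" "p \<le> r" and r: "r < DIM('a)"
    and gap: "lam (p + 1) < lam p"
    and lbar: "0 < lbar" "lbar \<le> lam p - lam (r + 1)"
    and x: "i \<in> {1..r} \<Longrightarrow> j \<in> {1..r} \<Longrightarrow> \<bar>u i \<bullet> E (u j)\<bar> \<le> x"
    and y: "j \<in> {p+1..r} \<Longrightarrow> i \<in> {1..p} \<Longrightarrow>
      \<bar>u j \<bullet> E (spectral_sum u {r+1..DIM('a)} (\<lambda>l. 1 / (lam p - lam l)) (E (u i)))\<bar> \<le> y"
    and y_nonneg: "0 \<le> y"
    and w: "i \<in> {1..r} \<Longrightarrow> norm (E (u i)) \<le> w"
    and e: "norm (E a) \<le> e * norm a"
    and gap_x: "12 * real r * x \<le> lam p - lam (p + 1)"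
    and gap_w: "144 * real r * w\<^sup>2 \<le> (lam p - lam (p + 1)) * lbar"
    and e_small: "6 * e \<le> lbar"
begin

sublocale E: linear E by (rule linE)

abbreviation "\<Delta> \<equiv> lam p - lam (p + 1)"
abbreviation "top_ix \<equiv> {1..p}"
abbreviation "mid_ix \<equiv> {p+1..r}"
abbreviation "T \<equiv> spectral_sum u {r+1..DIM('a)} (\<lambda>l. 1 / (lam p - lam l))"
text \<open>A bound for the norm of \<open>E\<close> restricted to the span of \<open>u\<^sub>1, \<dots>, u\<^sub>r\<close>.\<close>
abbreviation "h \<equiv> sqrt (real r) * w"

lemma u_sub: "I \<subseteq> {1..DIM('a)} \<Longrightarrow> orthonormal_on I u"
  by (rule orthonormal_on_subset[OF u])

lemma x_nonneg: "0 \<le> x"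
  using x[of 1 1] p by force

lemma w_nonneg: "0 \<le> w"
  by (rule order_trans[OF norm_ge_zero w[of 1]]) (use p in auto)

lemma e_nonneg: "0 \<le> e"
proof -
  have "norm (u 1) = 1"
    using orthonormal_onD[OF u, of 1 1] p r by (simp add: norm_eq_sqrt_inner)
  then show ?thesis using order_trans[OF norm_ge_zero e[of "u 1"]] by simp
qed

lemma h_sq: "h * h \<le> \<Delta> * lbar / 144"
  using gap_w by (simp add: power2_eq_square mult_ac)

lemma inner_linear_proj:
  assumes "linear F"
  shows "b \<bullet> F (proj u I a) = (\<Sum>i\<in>I. (b \<bullet> F (u i)) * (u i \<bullet> a))"
proof -
  interpret F: linear F by fact
  show ?thesis
    unfolding spectral_sum_def by (simp add: F.sum F.scale inner_sum_right mult_ac)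
qed

lemma norm_proj_E_le:
  assumes "I \<subseteq> {1..r}"
  shows "L2_set (\<lambda>j. u j \<bullet> E a) I \<le> h * norm a"
proof -
  have "card I \<le> r" using card_mono[OF _ assms] by simp
  have "L2_set (\<lambda>j. u j \<bullet> E a) I \<le> sqrt (card I) * (w * norm a)"
  proof (rule L2_set_le_sqrt_card)
    fix j assume "j \<in> I"
    then have j: "j \<in> {1..r}" using assms by blast
    have "\<bar>u j \<bullet> E a\<bar> \<le> norm (E (u j)) * norm a"
      unfolding selfE by (rule Cauchy_Schwarz_ineq2)
    also have "\<dots> \<le> w * norm a" by (rule mult_right_mono[OF w[OF j]]) simp
    finally show "\<bar>u j \<bullet> E a\<bar> \<le> w * norm a" .
  qed (simp add: w_nonneg)
  also have "\<dots> \<le> sqrt r * (w * norm a)"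
    by (rule mult_right_mono) (use \<open>card I \<le> r\<close> w_nonneg in auto)
  finally show ?thesis by (simp add: mult_ac)
qed

lemma norm_E_proj_le:
  assumes "I \<subseteq> {1..r}"
  shows "norm (E (proj u I a)) \<le> h * norm a"
proof -
  have "card I \<le> r" using card_mono[OF _ assms] by simp
  have I: "orthonormal_on I u" "finite I"
    using assms r by (auto intro!: u_sub finite_subset[OF assms])
  have "norm (E (proj u I a)) \<le> L2_set (\<lambda>i. u i \<bullet> a) I * L2_set (\<lambda>i. norm (E (u i))) I"
    unfolding spectral_sum_def by (simp add: E.sum E.scale norm_linear_combination_le)
  also have "\<dots> \<le> norm a * (sqrt (card I) * w)"
    by (intro mult_mono bessel_inequality[OF I] L2_set_le_sqrt_card)
      (use w assms w_nonneg in auto)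
  also have "\<dots> \<le> norm a * (sqrt r * w)"
    by (intro mult_left_mono mult_right_mono) (use \<open>card I \<le> r\<close> w_nonneg in auto)
  finally show ?thesis by (simp add: mult_ac)
qed

text \<open>
  The weaker bound \<open>lam p - e\<close> of Weyl's inequality would not do, as \<open>e\<close> may be much larger than
  \<open>\<Delta>\<close>.  Restricted to the span of \<open>u\<^sub>1, \<dots>, u\<^sub>p\<close>, however, \<open>E\<close> is a \<open>p \<times> p\<close> matrix with entries
  at most \<open>x\<close>.
\<close>
lemma mu_ge:
  assumes "k \<in> top_ix"
  shows "lam p - \<Delta> / 12 \<le> mu k"
proof -
  have "lam p - \<Delta> / 12 \<le> mu p"
  proof (rule eigenvalue_ge_of_quadratic_form[of "\<lambda>a. A a + E a" v mu p u])
    show "linear (\<lambda>a. A a + E a)" by (rule linear_compose_add[OF linA linE])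
    fix c assume c: "proj u top_ix c = c"
    have top: "orthonormal_on top_ix u" "finite top_ix" using p r by (auto intro!: u_sub)
    have nc: "norm c = L2_set (\<lambda>i. u i \<bullet> c) top_ix"
      using norm_spectral_sum[OF top, of "\<lambda>_. 1" c] c by simp
    have "c \<bullet> A c = c \<bullet> A (proj u top_ix c)" by (simp add: c)
    also have "\<dots> = (\<Sum>i\<in>top_ix. lam i * (u i \<bullet> c)\<^sup>2)"
      unfolding inner_linear_proj[OF linA] using p r
      by (intro sum.cong) (auto simp: Au power2_eq_square inner_commute)
    also have "\<dots> \<ge> (\<Sum>i\<in>top_ix. lam p * (u i \<bullet> c)\<^sup>2)"
      by (intro sum_mono mult_right_mono) (use lam_mono p r in auto)
    also have "(\<Sum>i\<in>top_ix. lam p * (u i \<bullet> c)\<^sup>2) = lam p * (norm c)\<^sup>2"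
      unfolding nc L2_set_def by (simp add: sum_nonneg sum_distrib_left)
    finally have 1: "lam p * (norm c)\<^sup>2 \<le> c \<bullet> A c" .
    have "c \<bullet> E c = proj u top_ix c \<bullet> E (proj u top_ix c)" by (simp add: c)
    also have "\<dots> = (\<Sum>i\<in>top_ix. (u i \<bullet> c) * (u i \<bullet> E (proj u top_ix c)))"
      by (subst (1) spectral_sum_def) (simp add: inner_sum_left)
    also have "\<dots> = (\<Sum>i\<in>top_ix. (u i \<bullet> c) * (\<Sum>j\<in>top_ix. (u i \<bullet> E (u j)) * (u j \<bullet> c)))"
      unfolding inner_linear_proj[OF linE] ..
    finally have "\<bar>c \<bullet> E c\<bar>
        \<le> norm c * L2_set (\<lambda>i. \<Sum>j\<in>top_ix. (u i \<bullet> E (u j)) * (u j \<bullet> c)) top_ix"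
      using norm_linear_combination_le[of "\<lambda>i. u i \<bullet> c"
          "\<lambda>i. \<Sum>j\<in>top_ix. (u i \<bullet> E (u j)) * (u j \<bullet> c)" top_ix]
      by (simp add: L2_set_abs nc)
    also have "\<dots> \<le> norm c * (sqrt (card top_ix) * (sqrt (card top_ix) * x) * norm c)"
      unfolding nc
      by (intro mult_left_mono L2_set_matrix_vector_le) (use x x_nonneg p in auto)
    also have "\<dots> = real p * x * (norm c)\<^sup>2"
      by (simp add: power2_eq_square)
    also have "\<dots> \<le> real r * x * (norm c)\<^sup>2"
      by (intro mult_right_mono) (use p x_nonneg in auto)
    also have "\<dots> \<le> \<Delta> / 12 * (norm c)\<^sup>2"
      by (intro mult_right_mono) (use gap_x in auto)
    finally show "(lam p - \<Delta> / 12) * (norm c)\<^sup>2 \<le> c \<bullet> (A c + E c)"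
      using 1 unfolding inner_add_right left_diff_distrib by linarith
  qed (use v Bv mu_mono p r in \<open>auto intro!: u_sub\<close>)
  also have "mu p \<le> mu k" using assms p r by (auto intro!: mu_mono)
  finally show ?thesis .
qed

lemma eigen_equation:
  assumes "l \<in> {1..DIM('a)}" "k \<in> {1..DIM('a)}"
  shows "(mu k - lam l) * (u l \<bullet> v k) = u l \<bullet> E (v k)"
proof -
  have "mu k * (u l \<bullet> v k) = u l \<bullet> (A (v k) + E (v k))" 
    by (simp only: Bv[OF assms(2)] inner_scaleR_right)
  also have "\<dots> = lam l * (u l \<bullet> v k) + u l \<bullet> E (v k)"
    unfolding inner_add_right selfA 
    by (simp only: Au[OF assms(1)] inner_scaleR_left)
  finally show ?thesis by (simp add: algebra_simps)
qed

lemma delta_le_tail_gap: "\<Delta> \<le> lam p - lam (r + 1)"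
  using lam_mono[of "p+1" "r+1"] p r by simp

lemma tail_gap:
  assumes "k \<in> top_ix" "l \<in> {r+1..DIM('a)}"
  shows "lam p - lam (r + 1) \<le> lam p - lam l" "11 / 12 * lbar \<le> mu k - lam (r + 1)"
    "mu k - lam (r + 1) \<le> mu k - lam l"
proof -
  have "lam l \<le> lam (r + 1)" using lam_mono[of "r+1" l] assms by simp
  then show "lam p - lam (r + 1) \<le> lam p - lam l" "mu k - lam (r + 1) \<le> mu k - lam l"
    by linarith+
  show "11 / 12 * lbar \<le> mu k - lam (r + 1)"
    using mu_ge[OF assms(1)] lbar(2) delta_le_tail_gap by (simp add: field_simps)
qed

lemma v_split:
  "v k = proj u {1..r} (v k) + proj u {r+1..DIM('a)} (v k)"
  "proj u {1..r} (v k) = proj u top_ix (v k) + proj u mid_ix (v k)"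
proof -
  have "proj u {1..r} (v k) + proj u {r+1..DIM('a)} (v k) = proj u ({1..r} \<union> {r+1..DIM('a)}) (v k)"
    unfolding spectral_sum_def by (rule sum.union_disjoint[symmetric]) auto
  also have "{1..r} \<union> {r+1..DIM('a)} = {1..DIM('a)}" using r by auto
  finally show "v k = proj u {1..r} (v k) + proj u {r+1..DIM('a)} (v k)"
    by (simp add: orthonormal_expansion[OF u])
  have "proj u top_ix (v k) + proj u mid_ix (v k) = proj u (top_ix \<union> mid_ix) (v k)"
    unfolding spectral_sum_def by (rule sum.union_disjoint[symmetric]) auto
  also have "top_ix \<union> mid_ix = {1..r}" using p by auto
  finally show "proj u {1..r} (v k) = proj u top_ix (v k) + proj u mid_ix (v k)" by simp
qed

lemma norm_v: "k \<in> top_ix \<Longrightarrow> norm (v k) = 1"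
  using orthonormal_onD[OF v, of k k] p r by (simp add: norm_eq_sqrt_inner)

lemma norm_proj_le:
  assumes "I \<subseteq> {1..DIM('a)}"
  shows "norm (proj u I a) \<le> norm a"
  using norm_spectral_sum_le[OF u_sub[OF assms] finite_subset[OF assms], of "\<lambda>_. 1" 1 a] by simp

text \<open>
  On the tail, \<open>E\<close> applied to \<open>z\<close> itself is absorbed because \<open>e \<le> lbar / 6\<close>; what is left is \<open>E\<close>
  applied to the part \<open>s\<close> in the span of \<open>u\<^sub>1, \<dots>, u\<^sub>r\<close>, of norm at most \<open>h\<close> and at most \<open>e\<close>.
  The two bounds serve different purposes: \<open>h\<^sup>2\<close> can be traded for \<open>\<Delta> lbar\<close>, while \<open>e / lbar\<close>
  appears in the final estimate.
\<close>
lemma tail_le: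
  assumes k: "k \<in> top_ix"
  defines "z \<equiv> proj u {r+1..DIM('a)} (v k)"
  shows "norm z \<le> 4 / 3 * (h / lbar)" and "norm z \<le> 4 / 3 * (e / lbar)"
proof -
  let ?s = "proj u {1..r} (v k)"
  have tl: "orthonormal_on {r+1..DIM('a)} u" "finite {r+1..DIM('a)}" by (auto intro!: u_sub)
  have kN: "k \<in> {1..DIM('a)}" using k p r by auto
  have "11 / 12 * lbar * norm z = L2_set (\<lambda>l. (11 / 12 * lbar) * (u l \<bullet> v k)) {r+1..DIM('a)}"
    unfolding z_def norm_spectral_sum[OF tl]
    by (subst L2_set_right_distrib) (use lbar in auto)
  also have "\<dots> \<le> L2_set (\<lambda>l. (mu k - lam l) * (u l \<bullet> v k)) {r+1..DIM('a)}"
  proof (rule L2_set_le_abs)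
    fix l assume l: "l \<in> {r+1..DIM('a)}"
    show "\<bar>11 / 12 * lbar * (u l \<bullet> v k)\<bar> \<le> \<bar>(mu k - lam l) * (u l \<bullet> v k)\<bar>"
      unfolding abs_mult[of _ "u l \<bullet> v k"]
      by (rule mult_right_mono) (use tail_gap[OF k l] lbar in auto)
  qed
  also have "\<dots> = L2_set (\<lambda>l. u l \<bullet> E (v k)) {r+1..DIM('a)}"
    by (rule L2_set_cong) (auto intro!: eigen_equation kN)
  also have "\<dots> \<le> norm (E (v k))" by (rule bessel_inequality[OF tl])
  also have "\<dots> = norm (E ?s + E z)"
    by (subst v_split(1)) (simp add: E.add z_def)
  also have "\<dots> \<le> norm (E ?s) + norm (E z)" by (rule norm_triangle_ineq)
  also have "norm (E z) \<le> e * norm z" by (rule e)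
  also have "e * norm z \<le> lbar / 6 * norm z"
    by (rule mult_right_mono) (use e_small in auto)
  finally have *: "3 / 4 * lbar * norm z \<le> norm (E ?s)" by (simp add: algebra_simps)
  have "norm (E ?s) \<le> h" using norm_E_proj_le[of "{1..r}" "v k"] norm_v[OF k] by simp
  with * have "3 / 4 * lbar * norm z \<le> h" by linarith
  then show "norm z \<le> 4 / 3 * (h / lbar)" using lbar by (simp add: field_simps)
  have "norm (E ?s) \<le> e * 1"
    using e[of ?s] norm_proj_le[of "{1..r}" "v k"] norm_v[OF k] r e_nonneg
    by (intro order_trans[OF e] mult_left_mono) auto
  with * have "3 / 4 * lbar * norm z \<le> e" by linarith
  then show "norm z \<le> 4 / 3 * (e / lbar)" using lbar by (simp add: field_simps)
qed

lemma norm_T_le: "norm (T a) \<le> norm a / lbar"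
proof -
  have "norm (T a) \<le> 1 / lbar * norm a"
  proof (rule norm_spectral_sum_le)
    fix l assume l: "l \<in> {r+1..DIM('a)}"
    show "\<bar>1 / (lam p - lam l)\<bar> \<le> 1 / lbar"
      using lam_mono[of "r+1" l] l lbar by (auto simp: abs_of_nonneg intro!: divide_left_mono mult_pos_pos)
  qed (use lbar in \<open>auto intro!: u_sub\<close>)
  then show ?thesis by simp
qed


text \<open>
  The second-order effective perturbation: a Schur complement that eliminates the tail, with the
  resolvent frozen at \<open>lam p\<close> so that it is the same for all eigenvectors.
\<close>
definition G :: "'a \<Rightarrow> 'a" where "G a = E a + E (T (E a))"

lemma linear_G: "linear G"
proof -
  interpret T: linear T by (rule linear_spectral_sum)
  show ?thesis
    by (rule linearI) (simp_all add: G_def E.add E.scale T.add T.scale scaleR_add_right)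
qed

text \<open>
  The remainder splits as \<open>z - T E s = b + d\<close>, where \<open>b\<close> comes from freezing the resolvent at
  \<open>lam p\<close> instead of \<open>mu k\<close> and \<open>d\<close> from \<open>E\<close> acting inside the tail.  The distance
  \<open>\<bar>mu k - lam p\<bar>\<close> may be large, but never exceeds the gap \<open>mu k - lam (p + 1)\<close> on the
  right-hand side, so \<open>b\<close> only costs \<open>(e / lbar)\<^sup>2 \<le> e / (6 lbar)\<close> relative to that gap.
  For \<open>d\<close>, each of the two passages between tail and the span of \<open>u\<^sub>1, \<dots>, u\<^sub>r\<close> costs \<open>h\<close>,
  and \<open>h\<^sup>2 \<le> \<Delta> lbar / 144\<close>.
\<close>
lemma mid_remainder_le:
  assumes k: "k \<in> top_ix"
  defines "s \<equiv> proj u {1..r} (v k)" and "z \<equiv> proj u {r+1..DIM('a)} (v k)"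
  shows "L2_set (\<lambda>j. u j \<bullet> E (z - T (E s))) mid_ix \<le> 1 / 2 * (e / lbar * (mu k - lam (p + 1)))"
proof -
  let ?t = "mu k - lam p" and ?tl = "{r+1..DIM('a)}"
  have kN: "k \<in> {1..DIM('a)}" using k p r by auto
  have tl: "orthonormal_on ?tl u" "finite ?tl" by (auto intro!: u_sub)
  have mid: "orthonormal_on mid_ix u" "finite mid_ix" using p r by (auto intro!: u_sub)
  have g: "11 / 12 * \<Delta> \<le> mu k - lam (p + 1)"
    using mu_ge[OF k] by (simp add: field_simps)
  define b where "b = spectral_sum u ?tl (\<lambda>l. 1 / (mu k - lam l) - 1 / (lam p - lam l)) (E s)"
  define d where "d = spectral_sum u ?tl (\<lambda>l. 1 / (mu k - lam l)) (E z)"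
  have Ev: "E (v k) = E s + E z" unfolding s_def z_def E.add[symmetric] v_split(1)[symmetric] ..
  have split: "z - T (E s) = b + d"
  proof -
    have "z = spectral_sum u ?tl (\<lambda>l. 1 / (mu k - lam l)) (E (v k))"
      unfolding z_def spectral_sum_def
    proof (rule sum.cong[OF refl])
      fix l assume l: "l \<in> ?tl"
      have "mu k - lam l \<noteq> 0" using tail_gap[OF k l] lbar by auto
      moreover have "(mu k - lam l) * (u l \<bullet> v k) = u l \<bullet> E (v k)"
        using l by (intro eigen_equation kN) auto
      ultimately show "(1 * (u l \<bullet> v k)) *\<^sub>R u l = (1 / (mu k - lam l) * (u l \<bullet> E (v k))) *\<^sub>R u l"
        by (simp add: field_simps)
    qed
    then show ?thesis
      unfolding b_def d_def Ev spectral_sum_def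
      by (simp add: inner_add_right algebra_simps sum.distrib sum_subtractf)
  qed
  have s1: "norm s \<le> 1"
    using norm_proj_le[of "{1..r}" "v k"] norm_v[OF k] r by (simp add: s_def)
  have Es: "norm (E s) \<le> e"
    using e[of s] mult_left_mono[OF s1 e_nonneg] by simp
  have hh: "0 \<le> h" by (simp add: w_nonneg)
  have "norm b \<le> 12 / 11 * \<bar>?t\<bar> / lbar\<^sup>2 * norm (E s)"
    unfolding b_def
  proof (rule norm_spectral_sum_le[OF tl])
    fix l assume l: "l \<in> ?tl"
    have 1: "11 / 12 * lbar \<le> mu k - lam l" "lbar \<le> lam p - lam l"
      using tail_gap[OF k l] lbar by linarith+
    then have pos: "0 < mu k - lam l" "0 < lam p - lam l" using lbar by linarith+
    have "11 / 12 * lbar * lbar \<le> (mu k - lam l) * (lam p - lam l)"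
      using 1 lbar pos by (intro mult_mono) auto
    then have 2: "11 / 12 * lbar\<^sup>2 \<le> (mu k - lam l) * (lam p - lam l)"
      by (simp add: power2_eq_square)
    have "1 / (mu k - lam l) - 1 / (lam p - lam l) = - ?t / ((mu k - lam l) * (lam p - lam l))"
      using pos by (simp add: field_simps)
    then have "\<bar>1 / (mu k - lam l) - 1 / (lam p - lam l)\<bar>
        = \<bar>?t\<bar> / ((mu k - lam l) * (lam p - lam l))"
      using pos by (simp add: abs_mult abs_minus_commute)
    also have "\<dots> \<le> \<bar>?t\<bar> / (11 / 12 * lbar\<^sup>2)"
      by (rule divide_left_mono[OF 2]) (use pos lbar in auto)
    finally show "\<bar>1 / (mu k - lam l) - 1 / (lam p - lam l)\<bar> \<le> 12 / 11 * \<bar>?t\<bar> / lbar\<^sup>2"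
      by simp
  qed simp
  also have "\<dots> \<le> 12 / 11 * \<bar>?t\<bar> / lbar\<^sup>2 * e"
    by (rule mult_left_mono[OF Es]) simp
  finally have nb: "norm b \<le> 12 / 11 * \<bar>?t\<bar> / lbar\<^sup>2 * e" .
  have "norm d \<le> 12 / 11 / lbar * norm (E z)"
    unfolding d_def
  proof (rule norm_spectral_sum_le[OF tl])
    fix l assume l: "l \<in> ?tl"
    have 1: "11 / 12 * lbar \<le> mu k - lam l"
      using tail_gap[OF k l] by linarith
    have "1 / (mu k - lam l) \<le> 1 / (11 / 12 * lbar)"
      by (rule divide_left_mono[OF 1]) (use 1 lbar in \<open>auto intro!: mult_pos_pos\<close>)
    moreover have "0 < mu k - lam l" using 1 lbar by linarith
    ultimately show "\<bar>1 / (mu k - lam l)\<bar> \<le> 12 / 11 / lbar" by simp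
  qed (use lbar in simp)
  also have "\<dots> \<le> 12 / 11 / lbar * (e * (4 / 3 * (h / lbar)))"
    using order_trans[OF e mult_left_mono[OF tail_le(1)[OF k] e_nonneg]] lbar
    by (intro mult_left_mono) (auto simp: z_def)
  finally have nd: "norm d \<le> 12 / 11 / lbar * (e * (4 / 3 * (h / lbar)))" .
  have "L2_set (\<lambda>j. u j \<bullet> E b) mid_ix \<le> norm (E b)" by (rule bessel_inequality[OF mid])
  also have "\<dots> \<le> e * (12 / 11 * \<bar>?t\<bar> / lbar\<^sup>2 * e)"
    using e[of b] mult_left_mono[OF nb e_nonneg] by linarith
  also have "\<dots> = (e / lbar) * (e / lbar) * (12 / 11 * \<bar>?t\<bar>)"
    by (simp add: power2_eq_square mult_ac)
  also have "\<dots> \<le> (e / lbar) * (1 / 6) * (12 / 11 * (mu k - lam (p + 1)))"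
  proof (intro mult_mono mult_left_mono)
    show "\<bar>?t\<bar> \<le> mu k - lam (p + 1)"
      using mu_ge[OF k] gap by (auto simp: abs_le_iff field_simps)
  qed (use e_small e_nonneg lbar in \<open>auto simp: field_simps\<close>)
  also have "c * (1 / 6) * (12 / 11 * g) = 2 / 11 * (c * g)" for c g :: real by simp
  finally have 1: "L2_set (\<lambda>j. u j \<bullet> E b) mid_ix \<le> 2 / 11 * (e / lbar * (mu k - lam (p + 1)))" .
  have "L2_set (\<lambda>j. u j \<bullet> E d) mid_ix \<le> h * norm d"
    by (rule norm_proj_E_le) auto
  also have "\<dots> \<le> h * (12 / 11 / lbar * (e * (4 / 3 * (h / lbar))))"
    by (rule mult_left_mono[OF nd hh])
  also have "\<dots> = h * h * (16 / 11 * (e / lbar / lbar))" by simp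
  also have "\<dots> \<le> \<Delta> * lbar / 144 * (16 / 11 * (e / lbar / lbar))"
    by (rule mult_right_mono[OF h_sq]) (use e_nonneg lbar in auto)
  also have "\<dots> = e / lbar * (\<Delta> / 99)" using lbar by (simp add: field_simps)
  also have "\<dots> \<le> e / lbar * ((mu k - lam (p + 1)) / 90)"
    by (rule mult_left_mono) (use g gap e_nonneg lbar in \<open>auto simp: field_simps\<close>)
  finally have 2: "L2_set (\<lambda>j. u j \<bullet> E d) mid_ix \<le> 1 / 90 * (e / lbar * (mu k - lam (p + 1)))"
    by simp
  have "0 \<le> e / lbar * (mu k - lam (p + 1))" using g gap e_nonneg lbar by simp
  moreover have "L2_set (\<lambda>j. u j \<bullet> E (z - T (E s))) mid_ix
      \<le> L2_set (\<lambda>j. u j \<bullet> E b) mid_ix + L2_set (\<lambda>j. u j \<bullet> E d) mid_ix"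
    unfolding split E.add inner_add_right by (rule L2_set_triangle_ineq)
  ultimately show ?thesis using 1 2 by linarith
qed

text \<open>
  The constants \<open>12\<close> and \<open>144\<close> of the hypotheses on the gap enter here:
  \<open>13 / 144 = 1 / 12 + 1 / 144\<close>.
\<close>
lemma mid_block_le:
  "L2_set (\<lambda>j. u j \<bullet> G (proj u mid_ix a)) mid_ix \<le> 13 / 144 * \<Delta> * norm (proj u mid_ix a)"
proof -
  let ?m = "proj u mid_ix a"
  have mid: "orthonormal_on mid_ix u" "finite mid_ix" using p r by (auto intro!: u_sub)
  have pm: "proj u mid_ix ?m = ?m"
    unfolding spectral_sum_def[of u mid_ix _ ?m]
    by (subst (2) spectral_sum_def)
      (intro sum.cong refl, simp add: inner_spectral_sum[OF mid(1) order_refl mid(2)])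
  have nm: "L2_set (\<lambda>i. u i \<bullet> a) mid_ix = norm ?m"
    using norm_spectral_sum[OF mid, of "\<lambda>_. 1" a] by simp
  have "L2_set (\<lambda>j. u j \<bullet> E ?m) mid_ix
      \<le> sqrt (card mid_ix) * (sqrt (card mid_ix) * x) * norm ?m"
    unfolding inner_linear_proj[OF linE] nm[symmetric]
    by (rule L2_set_matrix_vector_le) (use x x_nonneg in auto)
  also have "\<dots> = real (card mid_ix) * x * norm ?m" by simp
  also have "\<dots> \<le> real r * x * norm ?m"
    by (intro mult_right_mono) (use x_nonneg in auto)
  also have "\<dots> \<le> \<Delta> / 12 * norm ?m"
    by (intro mult_right_mono) (use gap_x in auto)
  finally have 1: "L2_set (\<lambda>j. u j \<bullet> E ?m) mid_ix \<le> \<Delta> / 12 * norm ?m" .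
  have "L2_set (\<lambda>j. u j \<bullet> E (T (E ?m))) mid_ix \<le> h * norm (T (E ?m))"
    by (rule norm_proj_E_le) auto
  also have "\<dots> \<le> h * (norm (E ?m) / lbar)"
    by (rule mult_left_mono[OF norm_T_le]) (simp add: w_nonneg)
  also have "\<dots> \<le> h * (h * norm ?m / lbar)"
    using norm_E_proj_le[of mid_ix ?m] unfolding pm
    by (intro mult_left_mono divide_right_mono) (use w_nonneg lbar in auto)
  also have "\<dots> = h * h * (norm ?m / lbar)" by simp
  also have "\<dots> \<le> \<Delta> * lbar / 144 * (norm ?m / lbar)"
    by (rule mult_right_mono[OF h_sq]) (use lbar in auto)
  also have "\<dots> = \<Delta> / 144 * norm ?m" using lbar by simp
  finally have 2: "L2_set (\<lambda>j. u j \<bullet> E (T (E ?m))) mid_ix \<le> \<Delta> / 144 * norm ?m" .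
  have "L2_set (\<lambda>j. u j \<bullet> G ?m) mid_ix
      \<le> L2_set (\<lambda>j. u j \<bullet> E ?m) mid_ix + L2_set (\<lambda>j. u j \<bullet> E (T (E ?m))) mid_ix"
    unfolding G_def inner_add_right by (rule L2_set_triangle_ineq)
  also have "\<dots> \<le> 13 / 144 * \<Delta> * norm ?m" using 1 2 by (simp add: algebra_simps)
  finally show ?thesis .
qed

text \<open>
  Comparing norms in the middle coordinates of the eigenvalue equation gives
  \<open>g \<parallel>m\<parallel> \<le> b + 13/132 g \<parallel>m\<parallel> + g e / (2 lbar)\<close> with \<open>g = mu k - lam (p + 1)\<close>, because
  \<open>\<Delta> \<le> 12/11 g\<close>.  The coupling \<open>b\<close> to the top is kept, as it is to be summed over \<open>k\<close>.
\<close>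
lemma mid_le:
  assumes k: "k \<in> top_ix"
  shows "norm (proj u mid_ix (v k))
    \<le> 2 * L2_set (\<lambda>j. u j \<bullet> G (proj u top_ix (v k))) mid_ix / \<Delta> + e / lbar"
proof -
  let ?a = "proj u top_ix (v k)" and ?m = "proj u mid_ix (v k)" and ?s = "proj u {1..r} (v k)"
  let ?z = "proj u {r+1..DIM('a)} (v k)" and ?g = "mu k - lam (p + 1)"
  let ?b = "L2_set (\<lambda>j. u j \<bullet> G ?a) mid_ix"
  have kN: "k \<in> {1..DIM('a)}" using k p r by auto
  have mid: "orthonormal_on mid_ix u" "finite mid_ix" using p r by (auto intro!: u_sub)
  have g: "11 / 12 * \<Delta> \<le> ?g" using mu_ge[OF k] by (simp add: field_simps)
  have gp: "0 < ?g" using g gap by (simp add: field_simps)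
  interpret G: linear G by (rule linear_G)
  have Ev: "E (v k) = G ?a + G ?m + E (?z - T (E ?s))"
  proof -
    have "E (v k) = E ?s + E ?z" unfolding E.add[symmetric] v_split(1)[symmetric] ..
    also have "\<dots> = G ?s + E (?z - T (E ?s))" by (simp add: G_def E.diff)
    finally show ?thesis by (simp add: v_split(2) G.add)
  qed
  have "?g * norm ?m = L2_set (\<lambda>j. ?g * (u j \<bullet> v k)) mid_ix"
    unfolding norm_spectral_sum[OF mid] by (subst L2_set_right_distrib) (use gp in auto)
  also have "\<dots> \<le> L2_set (\<lambda>j. (mu k - lam j) * (u j \<bullet> v k)) mid_ix"
  proof (rule L2_set_le_abs)
    fix j assume j: "j \<in> mid_ix"
    then have "lam j \<le> lam (p + 1)" using r by (intro lam_mono) auto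
    then show "\<bar>?g * (u j \<bullet> v k)\<bar> \<le> \<bar>(mu k - lam j) * (u j \<bullet> v k)\<bar>"
      unfolding abs_mult by (intro mult_right_mono) (use gp in auto)
  qed
  also have "\<dots> = L2_set (\<lambda>j. u j \<bullet> E (v k)) mid_ix"
    by (rule L2_set_cong) (use r in \<open>auto intro!: eigen_equation kN\<close>)
  also have "\<dots> \<le> L2_set (\<lambda>j. u j \<bullet> G ?a + u j \<bullet> G ?m) mid_ix
      + L2_set (\<lambda>j. u j \<bullet> E (?z - T (E ?s))) mid_ix"
    unfolding Ev inner_add_right by (rule L2_set_triangle_ineq)
  also have "L2_set (\<lambda>j. u j \<bullet> G ?a + u j \<bullet> G ?m) mid_ix
      \<le> ?b + L2_set (\<lambda>j. u j \<bullet> G ?m) mid_ix"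
    by (rule L2_set_triangle_ineq)
  also have "L2_set (\<lambda>j. u j \<bullet> G ?m) mid_ix \<le> 13 / 144 * \<Delta> * norm ?m" by (rule mid_block_le)
  also have "L2_set (\<lambda>j. u j \<bullet> E (?z - T (E ?s))) mid_ix \<le> 1 / 2 * (e / lbar * ?g)"
    by (rule mid_remainder_le[OF k])
  also have "13 / 144 * \<Delta> * norm ?m \<le> 13 / 132 * ?g * norm ?m"
    by (rule mult_right_mono) (use g in \<open>auto simp: field_simps\<close>)
  also have "13 / 132 * ?g * norm ?m = 13 / 132 * (?g * norm ?m)" by simp
  finally have 1: "?g * norm ?m \<le> ?b + 13 / 132 * (?g * norm ?m) + 1 / 2 * (e / lbar * ?g)"
    by simp
  have "11 / 12 * \<Delta> * (2 * ?b / \<Delta>) \<le> ?g * (2 * ?b / \<Delta>)"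
    by (rule mult_right_mono[OF g]) (use gap in simp)
  also have "11 / 12 * \<Delta> * (2 * ?b / \<Delta>) = 11 / 6 * ?b" using gap by (simp add: divide_simps)
  finally have 2: "11 / 6 * ?b \<le> ?g * (2 * ?b / \<Delta>)" .
  have 3: "0 \<le> e / lbar * ?g" using gp e_nonneg lbar by simp
  have "M \<le> X + Y"
    if "M \<le> b + 13 / 132 * M + 1 / 2 * Y" "11 / 6 * b \<le> X" "0 \<le> Y" "0 \<le> b" for M X Y b :: real
    using that by (simp add: field_simps)
  from this[OF 1 2 3 L2_set_nonneg]
  have "?g * norm ?m \<le> ?g * (2 * ?b / \<Delta>) + e / lbar * ?g" .
  then have "?g * norm ?m \<le> ?g * (2 * ?b / \<Delta> + e / lbar)" by (simp add: algebra_simps)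
  then show ?thesis using gp by (simp only: mult_le_cancel_left_pos)
qed

text \<open>
  Entries of \<open>G\<close> between middle and top are off-diagonal, hence bounded by \<open>x + y\<close>.
\<close>
lemma coupling_le:
  "L2_set (\<lambda>k. L2_set (\<lambda>j. u j \<bullet> G (proj u top_ix (v k))) mid_ix) top_ix
    \<le> sqrt (real r) * (sqrt (real p) * (x + y))"
proof -
  have top: "orthonormal_on top_ix u" "orthonormal_on top_ix v" "finite top_ix"
    using p r by (auto intro!: u_sub orthonormal_on_subset[OF v])
  have "L2_set (\<lambda>k. L2_set (\<lambda>j. u j \<bullet> G (proj u top_ix (v k))) mid_ix) top_ix
      \<le> sqrt (card mid_ix) * (sqrt (card top_ix) * (x + y))"
    unfolding inner_linear_proj[OF linear_G]
  proof (rule L2_set_block_le[OF top(1,3,2,3)])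
    fix j i assume "j \<in> mid_ix" "i \<in> top_ix"
    then show "\<bar>u j \<bullet> G (u i)\<bar> \<le> x + y"
      unfolding G_def inner_add_right using x[of j i] y[of j i] p
      by (intro order_trans[OF abs_triangle_ineq] add_mono) auto
  qed (use x_nonneg y_nonneg in simp)
  also have "\<dots> \<le> sqrt (real r) * (sqrt (real p) * (x + y))"
    by (intro mult_mono) (use x_nonneg y_nonneg in auto)
  finally show ?thesis .
qed

lemma leakage_le:
  "L2_set (\<lambda>k. norm (v k - proj u top_ix (v k))) top_ix
    \<le> 2 * (sqrt (real p) * (sqrt (real r) * (x + y) / \<Delta>)) + 3 * (sqrt (real p) * (e / lbar))"
proof -
  let ?b = "\<lambda>k. L2_set (\<lambda>j. u j \<bullet> G (proj u top_ix (v k))) mid_ix"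
  have eps: "0 \<le> e / lbar" using e_nonneg lbar by simp
  have "L2_set (\<lambda>k. norm (v k - proj u top_ix (v k))) top_ix
      \<le> L2_set (\<lambda>k. 2 / \<Delta> * ?b k + 3 * (e / lbar)) top_ix"
  proof (rule L2_set_mono)
    fix k assume k: "k \<in> top_ix"
    have "v k - proj u top_ix (v k) = proj u mid_ix (v k) + proj u {r+1..DIM('a)} (v k)"
      using v_split[of k] by (simp add: algebra_simps)
    then have "norm (v k - proj u top_ix (v k))
        \<le> norm (proj u mid_ix (v k)) + norm (proj u {r+1..DIM('a)} (v k))"
      by (simp only: norm_triangle_ineq)
    then show "norm (v k - proj u top_ix (v k)) \<le> 2 / \<Delta> * ?b k + 3 * (e / lbar)"
      using mid_le[OF k] tail_le(2)[OF k] eps by simp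
  qed simp
  also have "\<dots> \<le> L2_set (\<lambda>k. 2 / \<Delta> * ?b k) top_ix + L2_set (\<lambda>k. 3 * (e / lbar)) top_ix"
    by (rule L2_set_triangle_ineq)
  also have "L2_set (\<lambda>k. 2 / \<Delta> * ?b k) top_ix = 2 / \<Delta> * L2_set ?b top_ix"
    by (rule L2_set_right_distrib[symmetric]) (use gap in simp)
  also have "\<dots> \<le> 2 / \<Delta> * (sqrt (real r) * (sqrt (real p) * (x + y)))"
    by (rule mult_left_mono[OF coupling_le]) (use gap in simp)
  also have "L2_set (\<lambda>k. 3 * (e / lbar)) top_ix = 3 * sqrt (real p) * (e / lbar)"
    using e_nonneg lbar by (simp add: L2_set_constant)
  finally show ?thesis by (simp add: mult_ac)
qed

end

section \<open>Spectral projections of symmetric matrices\<close>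

lemma sum_outer_mult_vector:
  "(\<Sum>i\<in>I. f i *\<^sub>R outer (u i) (u i)) *v a = spectral_sum u I f a"
proof (induction I rule: infinite_finite_induct)
  case (insert i I)
  have "outer (u i) (u i) *v a = (u i \<bullet> a) *\<^sub>R u i"
    by (simp add: vec_eq_iff outer_def matrix_vector_mult_def inner_vec_def
        sum_distrib_left mult_ac)
  then show ?case
    using insert
    by (simp add: spectral_sum_def matrix_vector_mult_add_rdistrib
        scaleR_matrix_vector_assoc[symmetric])
qed (simp_all add: spectral_sum_def)

lemma le_max_or_zero: "finite S \<Longrightarrow> s \<in> S \<Longrightarrow> s \<le> max_or_zero S"
  by (auto simp: max_or_zero_def)

lemma max_or_zero_nonneg:
  assumes "finite S" "\<And>s. s \<in> S \<Longrightarrow> 0 \<le> s"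
  shows "0 \<le> max_or_zero S"
  using assms by (auto simp: max_or_zero_def intro: order_trans[OF _ Max_ge])

theorem theorem2p3:
  fixes A E :: "real^'n^'n"
    and lam lam' :: "nat \<Rightarrow> real"
    and u u' :: "nat \<Rightarrow> real^'n"
    and p r :: nat
    and \<delta> lbar :: real
  assumes "transpose A = A" and "transpose E = E"
    and "eigensystem A lam u"
    and "eigensystem (A + E) lam' u'"
    and "1 \<le> p" and "p < CARD('n)"
    and "\<delta> = lam p - lam (p + 1)" and "\<delta> > 0"
    and "lbar > 0"
    and "threshold_index CARD('n) lam p lbar r"
    and "\<delta> \<ge> max (12 * real r * pert_x E u r) (144 * real r * (pert_w E u r)^2 / lbar)"
  shows "spectral_norm (spectral_projection u' p - spectral_projection u p)
       \<le> 12 * sqrt (real p) * (relative_norm E lam u p r / \<delta>)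
         + 12 * sqrt (real p) * (spectral_norm E / lbar)"
proof -
  let ?I = "{1..p}" and ?e = "spectral_norm E" and ?x = "pert_x E u r" and ?y = "pert_y E lam u p r"
  let ?S = "L2_set (\<lambda>k. norm (u' k - proj u ?I (u' k))) ?I"
  have self: "a \<bullet> (M *v b) = (M *v a) \<bullet> b" if "transpose M = M" for M :: "real^'n^'n" and a b
    using that by (metis dot_lmul_matrix transpose_matrix_vector)
  have on: "orthonormal_on {1..CARD('n)} u" "orthonormal_on {1..CARD('n)} u'"
    using assms(3,4) unfolding eigensystem_def orthonormal_on_def by blast+
  have onI: "orthonormal_on ?I u" "orthonormal_on ?I u'"
    by (rule orthonormal_on_subset, rule on, use assms(6) in simp)+
  have e: "norm (E *v a) \<le> ?e * norm a" for a
    unfolding spectral_norm_def by (rule onorm[OF matrix_vector_mul_bounded_linear])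
  have rp: "p \<le> r" "r < CARD('n)" "lbar < lam p - lam (r + 1)"
  proof -
    show r: "r < CARD('n)" "lbar < lam p - lam (r + 1)"
      using assms(10) by (auto simp: threshold_index_def)
    \<comment> \<open>For \<open>s < p\<close>, \<open>lam (s + 1)\<close> is at least \<open>lam p\<close> and so cannot pass the threshold.\<close>
    show "p \<le> r"
    proof (rule ccontr)
      assume "\<not> p \<le> r"
      then have "lam p \<le> lam (r + 1)"
        using assms(3,6) r by (auto simp: eigensystem_def)
      then show False using r assms(9) by linarith
    qed
  qed
  have finx: "finite {\<bar>u i \<bullet> (E *v u j)\<bar> | i j. i \<in> {1..r} \<and> j \<in> {1..r}}"
    by (rule finite_subset[of _ "(\<lambda>(i, j). \<bar>u i \<bullet> (E *v u j)\<bar>) ` ({1..r} \<times> {1..r})"]) auto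
  have finy: "finite {\<bar>u i \<bullet> ((E ** resolvent_tail lam u r k ** E) *v u j)\<bar> | i j k.
      i \<in> {1..r} \<and> j \<in> {1..r} \<and> i \<noteq> j \<and> k \<in> {1..p}}"
    by (rule finite_subset[of _ "(\<lambda>(i, j, k). \<bar>u i \<bullet> ((E ** resolvent_tail lam u r k ** E) *v u j)\<bar>)
        ` ({1..r} \<times> {1..r} \<times> {1..p})"]) force+
  have x0: "0 \<le> ?x"
    unfolding pert_x_def by (rule max_or_zero_nonneg[OF finx]) auto
  have y0: "0 \<le> ?y"
    unfolding pert_y_def by (rule max_or_zero_nonneg[OF finy]) auto
  have rel: "relative_norm E lam u p r = sqrt (real r) * (?x + ?y)"
    by (simp add: relative_norm_def algebra_simps)
  have S: "2 * ?S \<le> 12 * sqrt (real p) * (relative_norm E lam u p r / \<delta>)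
      + 12 * sqrt (real p) * (?e / lbar)"
  proof (cases "6 * ?e \<le> lbar")
    case True
    interpret perturbed_eigenbasis "(*v) A" "(*v) E" lam lam' u u' p r ?x ?y "pert_w E u r" ?e lbar
    proof unfold_locales
      fix i j assume "i \<in> {1..r}" "j \<in> {1..r}"
      then show "\<bar>u i \<bullet> (E *v u j)\<bar> \<le> ?x"
        unfolding pert_x_def by (intro le_max_or_zero[OF finx]) blast
    next
      fix j i assume ji: "j \<in> {p+1..r}" "i \<in> {1..p}"
      have "u j \<bullet> (E *v (spectral_sum u {r+1..DIM(real^'n)} (\<lambda>l. 1 / (lam p - lam l)) (E *v u i)))
          = u j \<bullet> ((E ** resolvent_tail lam u r p ** E) *v u i)"
        by (simp add: resolvent_tail_def sum_outer_mult_vector[symmetric]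
            matrix_vector_mul_assoc matrix_mul_assoc)
      moreover have "\<bar>u j \<bullet> ((E ** resolvent_tail lam u r p ** E) *v u i)\<bar> \<le> ?y"
        unfolding pert_y_def
        by (rule le_max_or_zero[OF finy], rule CollectI, intro exI[of _ j] exI[of _ i] exI[of _ p])
          (use ji rp assms(5) in auto)
      ultimately show "\<bar>u j \<bullet> (E *v (spectral_sum u {r+1..DIM(real^'n)}
          (\<lambda>l. 1 / (lam p - lam l)) (E *v u i)))\<bar> \<le> ?y" by simp
    next
      fix i assume i: "i \<in> {1..r}"
      have "E *v u i = u i v* E" using assms(2) by (metis transpose_matrix_vector)
      then show "norm (E *v u i) \<le> pert_w E u r"
        unfolding pert_w_def using i by (intro le_max_or_zero) auto
    next
      show "144 * real r * (pert_w E u r)\<^sup>2 \<le> (lam p - lam (p + 1)) * lbar"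
        using assms(7,9,11) by (simp add: pos_divide_le_eq)
    qed (use assms(3-9,11) self[OF assms(1)] self[OF assms(2)] on e rp y0 True in
      \<open>auto simp: eigensystem_def matrix_vector_mult_add_rdistrib
        matrix_vector_right_distrib matrix_vector_mult_scaleR intro!: linearI\<close>)
    have "?S \<le> 2 * (sqrt (real p) * (relative_norm E lam u p r / \<delta>))
        + 3 * (sqrt (real p) * (?e / lbar))"
      using leakage_le unfolding rel assms(7) .
    moreover have "0 \<le> sqrt (real p) * (relative_norm E lam u p r / \<delta>)"
      "0 \<le> sqrt (real p) * (?e / lbar)"
      using x0 y0 assms(8,9) e_nonneg by (simp_all add: rel)
    ultimately show ?thesis unfolding mult.assoc by linarith
  next
    case False
    have "norm (u' k - proj u ?I (u' k)) \<le> 1" if k: "k \<in> ?I" for k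
    proof -
      have "(norm (u' k - proj u ?I (u' k)))\<^sup>2 \<le> (norm (u' k))\<^sup>2"
        by (simp add: norm_minus_proj[OF onI(1)] sum_nonneg)
      moreover have "norm (u' k) = 1"
        using orthonormal_onD[OF onI(2) k k] by (simp add: norm_eq_sqrt_inner)
      ultimately show ?thesis by (simp add: power_le_one_iff)
    qed
    then have "?S \<le> sqrt (card ?I) * 1"
      by (intro L2_set_le_sqrt_card) auto
    moreover have "sqrt (real p) * (1 / 6) \<le> sqrt (real p) * (?e / lbar)"
      using False assms(9) by (intro mult_left_mono) (auto simp: field_simps)
    moreover have "0 \<le> 12 * sqrt (real p) * (relative_norm E lam u p r / \<delta>)"
      using x0 y0 assms(8) by (simp add: rel)
    ultimately show ?thesis by simp
  qed
  have pr: "spectral_projection w p *v a = proj w ?I a" for w :: "nat \<Rightarrow> real^'n" and a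
    using sum_outer_mult_vector[of "\<lambda>_. 1" w ?I a] by (simp add: spectral_projection_def)
  show ?thesis
    unfolding spectral_norm_def[of "_ - _"]
  proof (rule onorm_le)
    fix a
    have "norm ((spectral_projection u' p - spectral_projection u p) *v a)
        = norm (proj u' ?I a - proj u ?I a)"
      by (simp add: matrix_vector_mult_diff_rdistrib pr)
    also have "\<dots> \<le> 2 * ?S * norm a" by (rule norm_proj_difference_le[OF onI]) simp
    also have "\<dots> \<le> (12 * sqrt (real p) * (relative_norm E lam u p r / \<delta>)
        + 12 * sqrt (real p) * (?e / lbar)) * norm a"
      by (rule mult_right_mono[OF S]) simp
    finally show "norm ((spectral_projection u' p - spectral_projection u p) *v a)
        \<le> (12 * sqrt (real p) * (relative_norm E lam u p r / \<delta>)
        + 12 * sqrt (real p) * (?e / lbar)) * norm a" .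
  qed
qed

end
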